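(* Let $1/4 \le d < 1$. There exists $n_0$ such that for every integer $n \ge n_0$ the following holds. If $\mathcal{F}$ is a family of $3$-element subsets of an $n$-element set $X$ with $\delta(\mathcal{F}) \ge d\binom{n}{2}$, then \[ |\partial \mathcal{F}| \ge \begin{cases} \left(4\sqrt{d}-2d-1\right)\binom{n}{2} & \text{if } \frac14 \le d < \frac{47-5\sqrt{57}}{24},\\[4pt] \left(\frac12 + \sqrt{\frac{4d-1}{12}}\right)\binom{n}{2} & \text{if } d \ge \frac{47-5\sqrt{57}}{24}.\end{cases} \] Moreover, these bounds are best possible up to an additive term of $O(n)$: for all sufficiently large $n$ there exists a family $\mathcal{F}$ of $3$-subsets of an $n$-set with $\delta(\mathcal{F}) \ge d\binom{n}{2}$ whose shadow size exceeds the corresponding bound above by at most $O(n)$ (the implied constant depending only on $d$).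
   Context: For a family $\mathcal{F}$ of $k$-subsets of a set $X$, the shadow $\partial\mathcal{F}$ is the family of all $(k-1)$-subsets of $X$ contained in some member of $\mathcal{F}$. For $x \in X$, $\mathcal{F}_x = \{F\setminus\{x\} : x \in F \in \mathcal{F}\}$, and the minimum degree is $\delta(\mathcal{F}) = \min_{x\in X} |\mathcal{F}_x|$. *)

theory Defs
  imports Complex_Main "HOL-Library.Ramsey"
begin

text \<open>
  A family of \<open>k\<close>-subsets of \<open>X\<close> is a set \<open>\<F> \<subseteq> nsets X k\<close>.
\<close>

definition shadow :: "nat \<Rightarrow> 'a set \<Rightarrow> 'a set set \<Rightarrow> 'a set set" where
  "shadow k X \<F> = {S \<in> nsets X (k - 1). \<exists>A\<in>\<F>. S \<subseteq> A}"

definition link :: "'a set set \<Rightarrow> 'a \<Rightarrow> 'a set set" where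
  "link \<F> x = {A - {x} | A. A \<in> \<F> \<and> x \<in> A}"

text \<open>The minimum is meaningful only for finite nonempty \<open>X\<close>.\<close>

definition min_degree :: "'a set \<Rightarrow> 'a set set \<Rightarrow> nat" where
  "min_degree X \<F> = Min ((\<lambda>x. card (link \<F> x)) ` X)"

definition shadow_density :: "real \<Rightarrow> real" where
  "shadow_density d =
     (if d < (47 - 5 * sqrt 57) / 24
      then 4 * sqrt d - 2 * d - 1
      else 1 / 2 + sqrt ((4 * d - 1) / 12))"

end

theory Submission
  imports Defs
begin

text \<open>
  Let \<open>G\<close> be the shadow, let \<open>v\<close> be a vertex of minimum degree \<open>x (n - 1)\<close> and \<open>R\<close> the set of its
  non-neighbours. The neighbourhood of \<open>v\<close> spans at least \<open>d (n choose 2)\<close> edges, so \<open>x \<ge> sqrt d\<close>;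
  adding the edges that meet \<open>R\<close>, of which at most \<open>(|R| - 1) choose 2\<close> are counted twice in the
  degree sum over \<open>R\<close>, gives edge density at least \<open>f x = d - 1 + 4 x - 3 x^2\<close>. It is also at
  least \<open>x\<close>. The concave \<open>f\<close> has the fixed point \<open>b = 1/2 + sqrt ((4 d - 1) / 12)\<close>, and
  \<open>f (sqrt d) = 4 sqrt d - 2 d - 1\<close>, so the density is at least the minimum of these two values.

  Equality at \<open>sqrt d\<close> holds for two overlapping cliques of size \<open>sqrt d n\<close>. Equality at \<open>b\<close> holds for
  every regular graph of degree \<open>b n\<close> whose complement is triangle-free; in the range of \<open>d\<close> where
  \<open>b\<close> is the minimum, \<open>b \<ge> 2/3\<close> leaves room for a circulant graph of this kind on any number of
  vertices.
\<close>

section \<open>Binomial coefficients and subset counts\<close>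

text \<open>Real subtraction keeps the identity valid at \<open>n = 0\<close>. Later counts are
  doubled so that binomials turn into polynomials.\<close>

lemma real_choose_two: "2 * real (n choose 2) = real n * (real n - 1)"
proof (cases n)
  case (Suc m)
  have "even (n * (n - 1))" by auto
  then have "2 * (n choose 2) = n * (n - 1)"
    by (simp only: choose_two dvd_mult_div_cancel)
  then have "real (2 * (n choose 2)) = real (n * (n - 1))" by simp
  then show ?thesis using Suc by (simp add: algebra_simps)
qed simp

lemma card_nsets_eq: "finite A \<Longrightarrow> card (nsets A k) = card A choose k"
  using n_subsets[of A k] by (simp add: nsets_def finite_subset cong: conj_cong)

subsection \<open>The density function\<close>

text \<open>With \<open>y\<close> in the role of \<open>sqrt d\<close>, squaring turns the
  comparison into the sign of a polynomial. On the given range this sign changes only at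
  \<open>w\<close>, the smaller root of \<open>6 * y^2 - 15 * y + 7\<close>, and \<open>w^2\<close>
  is the threshold.\<close>

lemma densities_compare:
  fixes y :: real
  assumes y: "1 / 2 \<le> y" "y < 1"
  defines "A \<equiv> 4 * y - 2 * y\<^sup>2 - 1" and "B \<equiv> 1 / 2 + sqrt ((4 * y\<^sup>2 - 1) / 12)"
  shows "y\<^sup>2 < (47 - 5 * sqrt 57) / 24 \<Longrightarrow> A \<le> B"
    and "(47 - 5 * sqrt 57) / 24 \<le> y\<^sup>2 \<Longrightarrow> B \<le> A"
proof -
  define w where "w = (15 - sqrt 57) / 12"
  have s57: "sqrt 57 * sqrt 57 = 57" "7 < sqrt 57" "sqrt 57 < 8"
    by (simp, rule real_less_rsqrt, simp, rule real_less_lsqrt, auto)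
  have w2: "w\<^sup>2 = (47 - 5 * sqrt 57) / 24"
    unfolding w_def using s57(1) by (simp add: power2_eq_square field_simps)
  have w: "7 / 12 < w" "w < 8 / 12" using s57 by (simp_all add: w_def)
  have root: "6 * w\<^sup>2 - 15 * w + 7 = 0"
    unfolding w_def using s57(1) by (simp add: power2_eq_square field_simps)
  have diff: "((4 * y\<^sup>2 - 1) / 12) - (A - 1 / 2)\<^sup>2
      = (2 * y - 1) * (1 - y) * (6 * y\<^sup>2 - 15 * y + 7) / 3"
    unfolding A_def by (simp add: power2_eq_square field_simps)
  have fac: "6 * y\<^sup>2 - 15 * y + 7 = (w - y) * (15 - 6 * (w + y))"
  proof -
    have "6 * y\<^sup>2 - 15 * y + 7 = 6 * y\<^sup>2 - 15 * y + 7 - (6 * w\<^sup>2 - 15 * w + 7)"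
      using root by simp
    also have "\<dots> = (w - y) * (15 - 6 * (w + y))"
      by (simp add: power2_eq_square algebra_simps)
    finally show ?thesis .
  qed
  \<comment> \<open>This factor is 6 times the distance from \<open>y\<close> up to the other root,
    which exceeds 1.\<close>
  have pos: "0 \<le> 15 - 6 * (w + y)" using w y by simp
  have A: "0 \<le> A - 1 / 2"
  proof -
    have "A - 1 / 2 = (2 * y - 1) * (3 - 2 * y) / 2"
      unfolding A_def by (simp add: power2_eq_square field_simps)
    moreover have "0 \<le> (2 * y - 1) * (3 - 2 * y)" using y by (intro mult_nonneg_nonneg) auto
    ultimately show ?thesis by simp
  qed
  show "A \<le> B" if "y\<^sup>2 < (47 - 5 * sqrt 57) / 24"
  proof -
    have "y < w" using that w by (intro power2_less_imp_less[of y w]) (auto simp: w2)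
    then have "0 \<le> ((4 * y\<^sup>2 - 1) / 12) - (A - 1 / 2)\<^sup>2"
      unfolding diff fac using y pos by simp
    then have "A - 1 / 2 \<le> sqrt ((4 * y\<^sup>2 - 1) / 12)"
      by (intro real_le_rsqrt) simp
    then show ?thesis by (simp add: B_def)
  qed
  show "B \<le> A" if "(47 - 5 * sqrt 57) / 24 \<le> y\<^sup>2"
  proof -
    have "w \<le> y" using that y by (intro power2_le_imp_le[of w y]) (auto simp: w2)
    then have "((4 * y\<^sup>2 - 1) / 12) - (A - 1 / 2)\<^sup>2 \<le> 0"
      unfolding diff fac using y pos
      by (intro divide_nonpos_pos mult_nonneg_nonpos mult_nonpos_nonneg) auto
    then have "sqrt ((4 * y\<^sup>2 - 1) / 12) \<le> A - 1 / 2"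
      using A by (intro real_le_lsqrt) auto
    then show ?thesis by (simp add: B_def)
  qed
qed

lemma shadow_density_eq_min:
  assumes "1 / 4 \<le> d" "d < 1"
  shows "shadow_density d
    = min (4 * sqrt d - 2 * d - 1) (1 / 2 + sqrt ((4 * d - 1) / 12))"
proof -
  have "1 / 2 \<le> sqrt d"
    using assms by (intro real_le_rsqrt) (simp add: power2_eq_square)
  moreover have "sqrt d < 1" using assms by simp
  ultimately show ?thesis
    using densities_compare[of "sqrt d"] assms
    by (auto simp: shadow_density_def min_def)
qed

text \<open>A concave quadratic on an interval is smallest at an endpoint, and its values at the two
  endpoints are the two branches of the density.\<close>

lemma shadow_density_le_quadratic:
  assumes d: "1 / 4 \<le> d" "d < 1"
    and x: "sqrt d \<le> x" "x \<le> 1 / 2 + sqrt ((4 * d - 1) / 12)"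
  shows "shadow_density d \<le> d - 1 + 4 * x - 3 * x\<^sup>2"
proof -
  define f where "f x = d - 1 + 4 * x - 3 * x\<^sup>2" for x :: real
  define s where "s = sqrt ((4 * d - 1) / 12)"
  define b where "b = 1 / 2 + s"
  have "s\<^sup>2 = (4 * d - 1) / 12" unfolding s_def using d by simp
  then have fb: "f b = b"
    by (simp add: f_def b_def power2_eq_square field_simps)
  have fy: "f (sqrt d) = 4 * sqrt d - 2 * d - 1" using d by (simp add: f_def)
  have diff: "f u - f v = (u - v) * (4 - 3 * (u + v))" for u v
    by (simp add: f_def power2_eq_square algebra_simps)
  have "f (sqrt d) \<le> f x \<or> f b \<le> f x"
  \<comment> \<open>The factor \<open>4 - 3 * (u + v)\<close> in \<open>diff\<close> decides which
    endpoint to use. If the sum exceeds 4/3, so does \<open>x + b\<close>, because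
    \<open>sqrt d <= b\<close>.\<close>
  proof (cases "x + sqrt d \<le> 4 / 3")
    case True
    then have "0 \<le> f x - f (sqrt d)" unfolding diff using x by simp
    then show ?thesis by simp
  next
    case False
    then have "f x - f b \<ge> 0"
      unfolding diff using x by (intro mult_nonpos_nonpos) (auto simp: b_def s_def)
    then show ?thesis by simp
  qed
  then show ?thesis
    unfolding shadow_density_eq_min[OF d] using fb fy by (auto simp: f_def b_def s_def)
qed

subsection \<open>Degrees in graphs\<close>

definition nbrs :: "'a set set \<Rightarrow> 'a \<Rightarrow> 'a set" where
  "nbrs E v = {u. {v, u} \<in> E}"

lemma nbrs_subset: "E \<subseteq> nsets X 2 \<Longrightarrow> nbrs E v \<subseteq> X - {v}"
  by (auto simp: nbrs_def nsets_def)

lemma card_nbrs: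
  assumes "E \<subseteq> nsets X 2"
  shows "card (nbrs E v) = card {e \<in> E. v \<in> e}"
proof (rule bij_betw_same_card[of "\<lambda>u. {v, u}"])
  have "\<exists>u. e = {v, u}" if "e \<in> E" "v \<in> e" for e
  proof -
    have "card e = 2" using that assms by (auto simp: nsets_def)
    then show ?thesis using that by (auto simp: card_2_iff)
  qed
  then have "\<exists>u. {v, u} \<in> E \<and> e = {v, u}" if "e \<in> E" "v \<in> e" for e
    using that by metis
  then show "bij_betw (\<lambda>u. {v, u}) (nbrs E v) {e \<in> E. v \<in> e}"
    by (auto simp: bij_betw_def inj_on_def nbrs_def doubleton_eq_iff image_iff)
qed

text \<open>An edge \<open>e\<close> satisfies \<open>1 + [e \<subseteq> R] = [e \<subseteq> X - R] + |e \<inter> R|\<close>; sum over all edges.\<close>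

lemma card_edges_split:
  assumes X: "finite X" and E: "E \<subseteq> nsets X 2" and R: "R \<subseteq> X"
  shows "card E + card {e \<in> E. e \<subseteq> R}
    = card {e \<in> E. e \<subseteq> X - R} + (\<Sum>u\<in>R. card (nbrs E u))"
proof -
  have finE: "finite E" using finite_subset[OF E finite_imp_finite_nsets[OF X]] .
  have finR: "finite R" using finite_subset[OF R X] .
  have edge: "1 + of_bool (e \<subseteq> R) = of_bool (e \<subseteq> X - R) + card (R \<inter> e)" if "e \<in> E" for e
  proof -
    have "e \<in> nsets X 2" using that E by auto
    then obtain a b where "e = {a, b}" "a \<in> X" "b \<in> X" "a \<noteq> b"
      by (rule nsets2_E)
    then show ?thesis
      by (cases "a \<in> R"; cases "b \<in> R") (auto simp: Int_insert_right)
  qed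
  have "(\<Sum>u\<in>R. card (nbrs E u)) = (\<Sum>u\<in>R. \<Sum>e\<in>E. of_bool (u \<in> e))"
    using finE by (simp add: card_nbrs[OF E] Int_def conj_commute)
  also have "\<dots> = (\<Sum>e\<in>E. card (R \<inter> e))"
    using finR by (subst sum.swap) (simp add: Int_def)
  finally have deg: "(\<Sum>u\<in>R. card (nbrs E u)) = (\<Sum>e\<in>E. card (R \<inter> e))" .
  have "card E + card {e \<in> E. e \<subseteq> R} = (\<Sum>e\<in>E. 1 + of_bool (e \<subseteq> R))"
    unfolding sum.distrib using finE by (simp add: Int_def)
  also have "\<dots> = (\<Sum>e\<in>E. of_bool (e \<subseteq> X - R) + card (R \<inter> e))"
    using edge by (intro sum.cong) auto
  also have "\<dots> = card {e \<in> E. e \<subseteq> X - R} + (\<Sum>e\<in>E. card (R \<inter> e))"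
    using finE by (simp add: sum.distrib Int_def)
  finally show ?thesis using deg by simp
qed

text \<open>The handshake lemma is the case \<open>R = X\<close> of the preceding count: every edge
  lies in \<open>R\<close> and none in its complement.\<close>

lemma sum_card_nbrs:
  assumes "finite X" "E \<subseteq> nsets X 2"
  shows "(\<Sum>u\<in>X. card (nbrs E u)) = 2 * card E"
proof -
  have "{e \<in> E. e \<subseteq> X} = E" "{e \<in> E. e \<subseteq> {}} = {}"
    using assms(2) by (auto simp: nsets_def)
  then show ?thesis using card_edges_split[OF assms order_refl] by (simp add: Collect_conv_if)
qed

lemma card_edges_within_le:
  assumes "finite S" "E \<subseteq> nsets X 2"
  shows "card {e \<in> E. e \<subseteq> S} \<le> card S choose 2"
proof -
  have "{e \<in> E. e \<subseteq> S} \<subseteq> nsets S 2" using assms(2) by (auto simp: nsets_def)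
  from card_mono[OF finite_imp_finite_nsets[OF assms(1)] this] show ?thesis
    by (simp add: card_nsets_eq[OF assms(1)])
qed

section \<open>The lower bound\<close>

text \<open>The family of triples is replaced by \<open>tri\<close>, a condition on the graph alone;
  it is applied with the shadow as \<open>E\<close>.\<close>

lemma edges_lower_bound:
  assumes d: "1 / 4 \<le> d" "d < 1"
    and X: "finite X" "card X = n" "n \<ge> 2" and E: "E \<subseteq> nsets X 2"
    and tri: "\<And>v. v \<in> X \<Longrightarrow> d * real (n choose 2) \<le> real (card {e \<in> E. e \<subseteq> nbrs E v})"
  shows "shadow_density d * real (n choose 2) \<le> real (card E)"
proof -
  define D where "D = shadow_density d"
  define b where "b = 1 / 2 + sqrt ((4 * d - 1) / 12)"
  have Db: "D \<le> b" unfolding D_def shadow_density_eq_min[OF d] b_def by simp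
  have "sqrt ((4 * d - 1) / 12) \<le> 1 / 2"
    using d by (intro real_le_lsqrt) (auto simp: power2_eq_square)
  then have D1: "D \<le> 1" using Db b_def by simp
  have "X \<noteq> {}" using X by auto
  then obtain v where v: "v \<in> X" "\<And>u. u \<in> X \<Longrightarrow> card (nbrs E v) \<le> card (nbrs E u)"
    using ex_min_if_finite[OF finite_imageI[OF X(1), of "\<lambda>u. card (nbrs E u)"]]
    by (metis (no_types, lifting) empty_is_image imageE imageI not_le)
  define N where "N = real n - 1"
  define k where "k = card (nbrs E v)"
  define R where "R = X - nbrs E v"
  have N: "N \<ge> 1" "real n = N + 1" using X by (auto simp: N_def)
  have nb: "nbrs E v \<subseteq> X - {v}" using nbrs_subset[OF E] .
  have finN: "finite (nbrs E v)" using finite_subset[OF nb] X by simp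
  have kn: "k \<le> n - 1"
    unfolding k_def using card_mono[OF _ nb] X v by simp
  have cR: "card R = n - k"
    unfolding R_def k_def using nb X by (subst card_Diff_subset) (auto intro: finN)
  define x where "x = real k / N"
  have kx: "real k = x * N" using N by (simp add: x_def)
  have kN: "real k \<le> N" using kn X by (simp add: N_def)
  have x: "0 \<le> x" "x \<le> 1" using N kN by (auto simp: x_def)
  have "n * k = (\<Sum>u\<in>X. k)" using X by simp
  also have "\<dots> \<le> (\<Sum>u\<in>X. card (nbrs E u))"
    using v(2) by (intro sum_mono) (simp add: k_def)
  also have "\<dots> = 2 * card E" by (rule sum_card_nbrs[OF X(1) E])
  finally have "real (n * k) \<le> real (2 * card E)" by linarith
  then have E1: "(N + 1) * (x * N) \<le> 2 * real (card E)" using kx N by simp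
  show ?thesis
  \<comment> \<open>If \<open>x > b\<close>, the degree sum alone gives edge density at least
    \<open>x\<close>. Otherwise \<open>x\<close> is shown to lie in the interval from
    \<open>sqrt d\<close> to \<open>b\<close>.\<close>
  proof (cases "x \<le> b")
    case False
    then have "D * ((N + 1) * N) \<le> x * ((N + 1) * N)"
      using Db N by (intro mult_right_mono) auto
    also have "\<dots> \<le> 2 * real (card E)" using E1 by (simp add: mult_ac)
    finally have "D * (2 * real (n choose 2)) \<le> 2 * real (card E)"
      unfolding real_choose_two N(2) by simp
    then show ?thesis by (simp add: D_def)
  next
    case True
    \<comment> \<open>The \<open>k\<close> neighbours of \<open>v\<close> span at most
      \<open>k choose 2\<close> edges, which forces \<open>sqrt d <= x\<close>.\<close>
    have "d * real (n choose 2) \<le> real (k choose 2)"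
      using tri[OF v(1)] card_edges_within_le[OF finN E] by (force simp: k_def)
    then have "d * (2 * real (n choose 2)) \<le> 2 * real (k choose 2)" by simp
    then have "d * ((N + 1) * N) \<le> x * N * (x * N - 1)"
      unfolding real_choose_two kx N(2) by simp
    then have "N * (d * (N + 1)) \<le> N * (x * (x * N - 1))" by (simp add: algebra_simps)
    then have "d * (N + 1) \<le> x * (x * N - 1)" using N by (simp only: mult_le_cancel_left_pos)
    then have "d * N \<le> x\<^sup>2 * N"
      using d x by (simp add: algebra_simps power2_eq_square)
    then have "d \<le> x\<^sup>2" using N by simp
    then have "sqrt d \<le> x" using x by (intro real_le_lsqrt) auto
    then have "D \<le> d - 1 + 4 * x - 3 * x\<^sup>2"
      unfolding D_def using True b_def by (intro shadow_density_le_quadratic d) auto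
    then have quad: "D * N \<le> (d - 1 + 4 * x - 3 * x\<^sup>2) * N" using N by simp
    have RX: "R \<subseteq> X" "X - R = nbrs E v" using nb by (auto simp: R_def)
    have vR: "v \<in> R" using nb v by (auto simp: R_def)
    \<comment> \<open>\<open>v\<close> has no neighbour in \<open>R\<close>, so edges inside
      \<open>R\<close> use only \<open>n - k - 1\<close> vertices.\<close>
    have "{e \<in> E. e \<subseteq> R} = {e \<in> E. e \<subseteq> R - {v}}"
    proof -
      have "v \<notin> e" if "e \<in> E" "e \<subseteq> R" for e
      proof
        assume "v \<in> e"
        moreover have "card e = 2" using that E by (auto simp: nsets_def)
        ultimately obtain u where "e = {v, u}" by (auto simp: card_2_iff)
        then show False using that by (auto simp: R_def nbrs_def)
      qed
      then show ?thesis by auto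
    qed
    then have "card {e \<in> E. e \<subseteq> R} \<le> (n - k - 1) choose 2"
      using card_edges_within_le[OF _ E, of "R - {v}"] X vR cR by (simp add: R_def)
    moreover have "(n - k) * k \<le> (\<Sum>u\<in>R. card (nbrs E u))"
    proof -
      have "(n - k) * k = (\<Sum>u\<in>R. k)" using cR by simp
      also have "\<dots> \<le> (\<Sum>u\<in>R. card (nbrs E u))"
        using v(2) by (intro sum_mono) (auto simp: k_def R_def)
      finally show ?thesis .
    qed
    ultimately have "card {e \<in> E. e \<subseteq> nbrs E v} + (n - k) * k \<le> card E + ((n - k - 1) choose 2)"
      using card_edges_split[OF X(1) E RX(1)] RX(2) by simp
    then have "2 * real (card {e \<in> E. e \<subseteq> nbrs E v}) + 2 * real ((n - k) * k)
        \<le> 2 * real (card E) + 2 * real ((n - k - 1) choose 2)"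
      by linarith
    moreover have "d * (2 * real (n choose 2)) \<le> 2 * real (card {e \<in> E. e \<subseteq> nbrs E v})"
      using tri[OF v(1)] by simp
    moreover have "real (n - k) = N + 1 - x * N" "real (n - k - 1) = N - x * N"
      using kn X kx N by auto
    then have "real ((n - k) * k) = (N + 1 - x * N) * (x * N)"
      "2 * real ((n - k - 1) choose 2) = (N - x * N) * (N - x * N - 1)"
      unfolding real_choose_two of_nat_mult kx by simp_all
    moreover have "2 * real (n choose 2) = (N + 1) * N"
      unfolding real_choose_two N(2) by simp
    ultimately have "d * ((N + 1) * N) + 2 * ((N + 1 - x * N) * (x * N))
        \<le> 2 * real (card E) + (N - x * N) * (N - x * N - 1)"
      by simp
    then have "N * ((d - 1 + 4 * x - 3 * x\<^sup>2) * N + d + x + 1) \<le> 2 * real (card E)"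
      by (simp add: algebra_simps power2_eq_square)
    \<comment> \<open>The lower-order terms suffice because \<open>D <= 1 <= d + x + 1\<close>;
      hence the bound carries no error term.\<close>
    moreover have "N * (D * N + D) \<le> N * ((d - 1 + 4 * x - 3 * x\<^sup>2) * N + d + x + 1)"
      using quad D1 x(1) d(1) N(1) by (intro mult_left_mono) linarith+
    ultimately have "N * (D * N + D) \<le> 2 * real (card E)" by linarith
    then have "D * (2 * real (n choose 2)) \<le> 2 * real (card E)"
      unfolding real_choose_two N(2) by (simp add: algebra_simps)
    then show ?thesis by (simp add: D_def)
  qed
qed

lemma min_degree_le: "finite X \<Longrightarrow> v \<in> X \<Longrightarrow> min_degree X \<F> \<le> card (link \<F> v)"
  by (simp add: min_degree_def)

lemma le_min_degree:
  "finite X \<Longrightarrow> X \<noteq> {} \<Longrightarrow> (\<And>v. v \<in> X \<Longrightarrow> c \<le> real (card (link \<F> v)))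
    \<Longrightarrow> c \<le> real (min_degree X \<F>)"
  unfolding min_degree_def
  using Min_in[of "(\<lambda>x. card (link \<F> x)) ` X"] by fastforce

text \<open>All pairs of a triple lie in the shadow, so a triple through \<open>v\<close> is a
  triangle of the shadow graph. This supplies \<open>tri\<close>.\<close>

lemma link_subset_shadow:
  assumes \<F>: "\<F> \<subseteq> nsets X 3"
  shows "link \<F> v \<subseteq> {e \<in> shadow 3 X \<F>. e \<subseteq> nbrs (shadow 3 X \<F>) v}"
proof
  fix e assume "e \<in> link \<F> v"
  then obtain A where A: "A \<in> \<F>" "v \<in> A" "e = A - {v}" by (auto simp: link_def)
  then have A': "finite A" "card A = 3" "A \<subseteq> X" using \<F> by (auto simp: nsets_def)
  then have "e \<in> shadow 3 X \<F>" using A by (auto simp: shadow_def nsets_def)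
  moreover have "{v, u} \<in> shadow 3 X \<F>" if "u \<in> e" for u
    using that A A' by (auto simp: shadow_def nsets_def intro!: bexI[of _ A])
  ultimately show "e \<in> {e \<in> shadow 3 X \<F>. e \<subseteq> nbrs (shadow 3 X \<F>) v}"
    by (auto simp: nbrs_def)
qed

lemma shadow_lower_bound:
  assumes d: "1 / 4 \<le> d" "d < 1"
    and X: "finite X" "card X = n" "n \<ge> 2" and \<F>: "\<F> \<subseteq> nsets X 3"
    and deg: "d * real (n choose 2) \<le> real (min_degree X \<F>)"
  shows "shadow_density d * real (n choose 2) \<le> real (card (shadow 3 X \<F>))"
proof (rule edges_lower_bound[OF d X])
  show sub: "shadow 3 X \<F> \<subseteq> nsets X 2" by (auto simp: shadow_def)
  have fin: "finite (shadow 3 X \<F>)"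
    using finite_subset[OF sub finite_imp_finite_nsets[OF X(1)]] .
  fix v assume "v \<in> X"
  have "min_degree X \<F> \<le> card (link \<F> v)" using X \<open>v \<in> X\<close> by (intro min_degree_le)
  also have "\<dots> \<le> card {e \<in> shadow 3 X \<F>. e \<subseteq> nbrs (shadow 3 X \<F>) v}"
    using fin by (intro card_mono link_subset_shadow \<F>) auto
  finally show "d * real (n choose 2)
      \<le> real (card {e \<in> shadow 3 X \<F>. e \<subseteq> nbrs (shadow 3 X \<F>) v})"
    using deg by linarith
qed

subsection \<open>Constructions\<close>

text \<open>The largest family of triples whose shadow lies in \<open>E\<close>, hence the best
  choice for the minimum degree.\<close>

definition triangles :: "'a set \<Rightarrow> 'a set set \<Rightarrow> 'a set set" where
  "triangles X E = {T \<in> nsets X 3. nsets T 2 \<subseteq> E}"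

lemma shadow_triangles: "shadow 3 X (triangles X E) \<subseteq> E"
  by (auto simp: shadow_def triangles_def nsets_def)

text \<open>Converse to \<open>link_subset_shadow\<close>: the pairs in \<open>insert v e\<close>
  are \<open>e\<close> itself and pairs joining \<open>v\<close> to a neighbour.\<close>

lemma link_triangles:
  assumes E: "E \<subseteq> nsets X 2" and v: "v \<in> X"
  shows "{e \<in> E. e \<subseteq> nbrs E v} \<subseteq> link (triangles X E) v"
proof
  fix e assume e: "e \<in> {e \<in> E. e \<subseteq> nbrs E v}"
  then have e2: "finite e" "card e = 2" "e \<subseteq> X" using E by (auto simp: nsets_def)
  have ve: "v \<notin> e" using e nbrs_subset[OF E, of v] by auto
  have "f \<in> E" if f: "f \<subseteq> insert v e" "card f = 2" for f
  proof (cases "v \<in> f")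
    case True
    then obtain u where "f = {v, u}" "u \<noteq> v" using f by (auto simp: card_2_iff)
    then show ?thesis using f e by (auto simp: nbrs_def)
  next
    case False
    then have "f \<subseteq> e" using f by auto
    then have "f = e" using f e2 by (intro card_subset_eq) auto
    then show ?thesis using e by simp
  qed
  then have "insert v e \<in> triangles X E"
    using e2 ve v by (auto simp: triangles_def nsets_def)
  then show "e \<in> link (triangles X E) v"
    using ve by (auto simp: link_def intro!: exI[of _ "insert v e"])
qed

text \<open>Reduces sharpness to finding a graph with few edges in which every neighbourhood spans
  many.\<close>

lemma triangles_construction:
  assumes X: "finite X" "X \<noteq> {}" and E: "E \<subseteq> nsets X 2"
    and t: "\<And>v. v \<in> X \<Longrightarrow> c \<le> real (card {e \<in> E. e \<subseteq> nbrs E v})"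
  shows "c \<le> real (min_degree X (triangles X E))"
    and "card (shadow 3 X (triangles X E)) \<le> card E"
proof -
  have fin: "finite E" using finite_subset[OF E finite_imp_finite_nsets[OF X(1)]] .
  then show "card (shadow 3 X (triangles X E)) \<le> card E"
    by (intro card_mono shadow_triangles)
  show "c \<le> real (min_degree X (triangles X E))"
  proof (rule le_min_degree[OF X])
    fix v assume v: "v \<in> X"
    have "finite (triangles X E)"
      using finite_imp_finite_nsets[OF X(1), of 3] by (simp add: triangles_def)
    then have "finite (link (triangles X E) v)"
      by (auto simp: link_def)
    then have "card {e \<in> E. e \<subseteq> nbrs E v} \<le> card (link (triangles X E) v)"
      by (intro card_mono link_triangles E v)
    then show "c \<le> real (card (link (triangles X E) v))" using t[OF v] by linarith
  qed
qed

section \<open>Two overlapping cliques\<close>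

text \<open>Since \<open>sqrt d >= 1/2\<close>, two cliques of size about \<open>sqrt d * n\<close>
  cover all vertices, and the rest of one clique already gives each vertex enough edges in its
  neighbourhood.\<close>

lemma two_cliques_construction:
  assumes d: "1 / 4 \<le> d" "d < 1" and n: "n > 0" "sqrt d * real n + 3 \<le> real n"
  shows "\<exists>(X :: nat set) \<F>. finite X \<and> card X = n \<and> \<F> \<subseteq> nsets X 3 \<and>
    d * real (n choose 2) \<le> real (min_degree X \<F>) \<and>
    real (card (shadow 3 X \<F>)) \<le> (4 * sqrt d - 2 * d - 1) * real (n choose 2) + 10 * real n"
proof -
  define y where "y = sqrt d"
  have y: "1 / 2 \<le> y" "y < 1" "y\<^sup>2 = d"
    using d real_le_rsqrt[of "1 / 2" d] by (auto simp: y_def power2_eq_square)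
  \<comment> \<open>The added 2 makes both \<open>a - 1\<close> and \<open>a - 2\<close> at least
    \<open>y * n\<close>, so \<open>(a - 1) * (a - 2) >= d * n^2\<close>.\<close>
  define a where "a = nat \<lceil>y * n\<rceil> + 2"
  have a: "y * n + 2 \<le> real a" "real a \<le> y * n + 3"
    using y by (auto simp: a_def, linarith+)
  have an: "a \<le> n" using a n y_def by simp
  have "1 / 2 * real n \<le> y * real n" using y by (intro mult_right_mono) auto
  then have a2: "n \<le> 2 * a" using a by linarith
  define X where "X = {0..<n}"
  define A where "A = {0..<a}"
  define B where "B = {n - a..<n}"
  have AB: "A \<subseteq> X" "B \<subseteq> X" "card A = a" "card B = a" "finite A" "finite B" "A \<inter> B = {n - a..<a}"
    "A \<union> B = X"
    using an a2 by (auto simp: A_def B_def X_def)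
  define E where "E = nsets A 2 \<union> nsets B 2"
  have E: "E \<subseteq> nsets X 2" using AB by (auto simp: E_def nsets_def)
  have X: "finite X" "card X = n" "X \<noteq> {}" using n by (auto simp: X_def)
  have clique: "d * real (n choose 2) \<le> real (card {e \<in> E. e \<subseteq> nbrs E v})"
    if "v \<in> C" "C = A \<or> C = B" for v C
  proof -
    have C: "card C = a" "finite C" using that AB by auto
    have "C - {v} \<subseteq> nbrs E v" using that by (auto simp: E_def nbrs_def)
    then have "nsets (C - {v}) 2 \<subseteq> {e \<in> E. e \<subseteq> nbrs E v}"
      using that by (auto simp: E_def nsets_def)
    moreover have "finite {e \<in> E. e \<subseteq> nbrs E v}"
      using finite_imp_finite_nsets[OF AB(5)] finite_imp_finite_nsets[OF AB(6)]
      by (auto simp: E_def)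
    ultimately have le: "(a - 1) choose 2 \<le> card {e \<in> E. e \<subseteq> nbrs E v}"
      using card_mono[of _ "nsets (C - {v}) 2"] C that by (simp add: card_nsets_eq)
    have "d * (real n * (real n - 1)) \<le> d * (real n * real n)"
      using d by (intro mult_left_mono) auto
    also have "\<dots> = (y * n) * (y * n)" using y by (simp add: power2_eq_square algebra_simps)
    also have "\<dots> \<le> real (a - 1) * (real (a - 1) - 1)"
    proof -
      have "real (a - 1) = real a - 1" by (simp add: a_def)
      moreover have "0 \<le> y * n" using y by simp
      ultimately show ?thesis using a(1) by (intro mult_mono) linarith+
    qed
    finally have "d * (2 * real (n choose 2)) \<le> 2 * real ((a - 1) choose 2)"
      unfolding real_choose_two .
    then show ?thesis using le by linarith
  qed
  have t: "d * real (n choose 2) \<le> real (card {e \<in> E. e \<subseteq> nbrs E v})" if "v \<in> X" for v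
    using clique[of v A] clique[of v B] that AB by blast
  have "nsets A 2 \<inter> nsets B 2 = nsets {n - a..<a} 2"
    unfolding AB(7)[symmetric] by (auto simp: nsets_def)
  then have "card E + (2 * a - n choose 2) = (a choose 2) + (a choose 2)"
    using card_Un_Int[OF AB(5,6)[THEN finite_imp_finite_nsets], of 2 2] AB an a2
    by (simp add: E_def card_nsets_eq mult_2)
  then have "2 * real (card E) + 2 * real (2 * a - n choose 2) = 2 * (2 * real (a choose 2))"
    by linarith
  then have "2 * real (card E) = 2 * (real a * (real a - 1))
      - (2 * real a - real n) * (2 * real a - real n - 1)"
    unfolding real_choose_two using a2 by simp
  \<comment> \<open>The missing pairs join the complements of the two cliques,
    \<open>(n - a)^2\<close> in number.\<close>
  also have "\<dots> = n\<^sup>2 - n - 2 * (real n - real a)\<^sup>2"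
    by (simp add: power2_eq_square algebra_simps)
  \<comment> \<open>Squaring is monotone here because \<open>y * n + 3 <= n\<close>.\<close>
  also have "\<dots> \<le> n\<^sup>2 - n - 2 * (real n - (y * n + 3))\<^sup>2"
    using a n y_def by (intro diff_left_mono mult_left_mono power_mono) auto
  also have "\<dots> = (4 * y - 2 * d - 1) * n\<^sup>2 + (11 - 12 * y) * n - 18"
    unfolding y(3)[symmetric] by (simp add: power2_eq_square algebra_simps)
  also have "\<dots> \<le> (4 * y - 2 * d - 1) * (n * (real n - 1)) + 20 * n"
  proof -
    have "(8 * y + 2 * d + 10) * real n \<ge> 0" using y d by simp
    then show ?thesis by (simp add: power2_eq_square algebra_simps)
  qed
  finally have "real (card E) \<le> (4 * y - 2 * d - 1) * real (n choose 2) + 10 * n"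
    unfolding real_choose_two[symmetric] by simp
  then show ?thesis
    using triangles_construction[OF X(1,3) E t] X
    by (intro exI[of _ X] exI[of _ "triangles X E"])
       (auto simp: triangles_def y_def)
qed

section \<open>Powers of a cycle as extremal graphs\<close>

text \<open>The \<open>r\<close>-th power of the \<open>n\<close>-cycle: adjacency means cyclic
  distance at most \<open>r\<close>, the second disjunct measuring across the wrap-around. Ordering
  \<open>x < y\<close> keeps \<open>y - x\<close> from being truncated.\<close>

definition circulant :: "nat \<Rightarrow> nat \<Rightarrow> nat set set" where
  "circulant n r = {{x, y} | x y. x < y \<and> y < n \<and> (y - x \<le> r \<or> n - r \<le> y - x)}"

lemma circulant_nsets: "circulant n r \<subseteq> nsets {0..<n} 2"
  by (auto simp: circulant_def nsets_def)

text \<open>An order-free form. One of the truncated differences is 0, so the conjunction bounds the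
  absolute difference; a wrap-around disjunct with difference 0 would need \<open>n <= r\<close>,
  when all distinct vertices are adjacent anyway.\<close>

lemma doubleton_in_circulant:
  "{x, y} \<in> circulant n r \<longleftrightarrow> x \<noteq> y \<and> x < n \<and> y < n \<and>
    (x - y \<le> r \<and> y - x \<le> r \<or> n \<le> x - y + r \<or> n \<le> y - x + r)"
proof -
  have sorted: "{p, q} \<in> circulant n r \<longleftrightarrow> q < n \<and> (q - p \<le> r \<or> n - r \<le> q - p)"
    if "p < q" for p q
  proof
    assume "{p, q} \<in> circulant n r"
    then obtain p' q' where "{p, q} = {p', q'}" "p' < q'" "q' < n" "q' - p' \<le> r \<or> n - r \<le> q' - p'"
      by (auto simp: circulant_def)
    moreover from this(1,2) that have "p' = p" "q' = q" by (auto simp: doubleton_eq_iff)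
    ultimately show "q < n \<and> (q - p \<le> r \<or> n - r \<le> q - p)" by simp
  next
    assume "q < n \<and> (q - p \<le> r \<or> n - r \<le> q - p)"
    then show "{p, q} \<in> circulant n r" using that unfolding circulant_def by blast
  qed
  have "{z} \<notin> circulant n r" for z
    using circulant_nsets[of n r] by (auto simp: nsets_def)
  then show ?thesis
    using sorted[of x y] sorted[of y x]
    by (cases x y rule: linorder_cases) (auto simp: insert_commute)
qed

text \<open>The three cyclic gaps between the vertices sum to \<open>n <= 3 * r + 2\<close>, so one
  of them is at most \<open>r\<close>.\<close>

lemma circulant_complement_triangle_free:
  assumes "x \<noteq> y" "y \<noteq> z" "x \<noteq> z" "x < n" "y < n" "z < n" and n: "n < 3 * r + 3"
  shows "{x, y} \<in> circulant n r \<or> {y, z} \<in> circulant n r \<or> {x, z} \<in> circulant n r"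
proof -
  have sorted: "{p, q} \<in> circulant n r \<or> {q, s} \<in> circulant n r \<or> {p, s} \<in> circulant n r"
    if "p < q" "q < s" "s < n" for p q s
  proof -
    have "q - p \<le> r \<or> s - q \<le> r \<or> n - r \<le> s - p" using that n by linarith
    then show ?thesis using that by (auto simp: doubleton_in_circulant)
  qed
  consider "x < y \<and> y < z" | "x < z \<and> z < y" | "y < x \<and> x < z"
    | "y < z \<and> z < x" | "z < x \<and> x < y" | "z < y \<and> y < x"
    using assms(1-3) by linarith
  then show ?thesis
    using assms(4-6) sorted[of x y z] sorted[of x z y] sorted[of y x z]
      sorted[of y z x] sorted[of z x y] sorted[of z y x]
    by cases (auto simp: insert_commute)
qed

lemma card_nbrs_circulant:
  assumes x: "x < n" and r: "2 * r < n"
  shows "card (nbrs (circulant n r) x) = 2 * r"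
proof -
  have eq: "nbrs (circulant n r) x = {y. x \<noteq> y \<and> y < n \<and>
      (x - y \<le> r \<and> y - x \<le> r \<or> n \<le> x - y + r \<or> n \<le> y - x + r)}"
    using x by (auto simp: nbrs_def doubleton_in_circulant)
  \<comment> \<open>The window of radius \<open>r\<close> around \<open>x\<close> wraps below 0,
    does not wrap, or wraps past \<open>n - 1\<close>. By \<open>2 * r < n\<close> its parts do not
    overlap.\<close>
  consider "x < r" | "r \<le> x" "x < n - r" | "n - r \<le> x" by linarith
  then show ?thesis
  proof cases
    case 1
    then have "nbrs (circulant n r) x = ({0..<x} \<union> {x<..x + r}) \<union> {x + n - r..<n}"
      unfolding eq using x r by auto
    also have "card \<dots> = card ({0..<x} \<union> {x<..x + r}) + card {x + n - r..<n}"
      using 1 r by (intro card_Un_disjoint) auto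
    also have "card ({0..<x} \<union> {x<..x + r}) = x + r"
      by (subst card_Un_disjoint) auto
    finally show ?thesis using 1 r by simp
  next
    case 2
    then have "nbrs (circulant n r) x = {x - r..<x} \<union> {x<..x + r}"
      unfolding eq using x r by auto
    also have "card \<dots> = 2 * r" using 2 by (subst card_Un_disjoint) auto
    finally show ?thesis .
  next
    case 3
    then have "nbrs (circulant n r) x = ({x - r..<x} \<union> {x<..<n}) \<union> {0..<x + r + 1 - n}"
      unfolding eq using x r by auto
    also have "card \<dots> = card ({x - r..<x} \<union> {x<..<n}) + card {0..<x + r + 1 - n}"
      using 3 r x by (intro card_Un_disjoint) auto
    also have "card ({x - r..<x} \<union> {x<..<n}) = r + (n - x - 1)"
      using 3 r by (subst card_Un_disjoint) auto
    finally show ?thesis using 3 r x by simp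
  qed
qed

lemma card_circulant:
  assumes "2 * r < n"
  shows "card (circulant n r) = n * r"
  using sum_card_nbrs[OF _ circulant_nsets, of n r] card_nbrs_circulant assms by simp

text \<open>The count behind the lower bound becomes an equality: the graph is regular, and the
  non-neighbours of \<open>v\<close> form a clique.\<close>

lemma card_triangles_circulant:
  assumes v: "v < n" and r: "2 * r < n" "n < 3 * r + 3"
  shows "card {e \<in> circulant n r. e \<subseteq> nbrs (circulant n r) v} + (n - 2 * r) * (2 * r)
    = n * r + ((n - 2 * r - 1) choose 2)"
proof -
  let ?E = "circulant n r"
  define X where "X = {0..<n}"
  define R where "R = X - nbrs ?E v"
  have E: "?E \<subseteq> nsets X 2" using circulant_nsets by (simp add: X_def)
  have nb: "nbrs ?E v \<subseteq> X - {v}" using nbrs_subset[OF E] .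
  have finN: "finite (nbrs ?E v)" using finite_subset[OF nb] by (simp add: X_def)
  have R: "R \<subseteq> X" "X - R = nbrs ?E v" "v \<in> R" "finite R"
    using nb v by (auto simp: R_def X_def)
  have cR: "card R = n - 2 * r"
    unfolding R_def using nb card_nbrs_circulant[OF v r(1)]
    by (subst card_Diff_subset[OF finN]) (auto simp: X_def)
  \<comment> \<open>Two non-neighbours of \<open>v\<close> are adjacent, as otherwise they would
    form a triangle of the complement with \<open>v\<close>.\<close>
  have "{e \<in> ?E. e \<subseteq> R} = nsets (R - {v}) 2"
  proof (intro equalityI subsetI)
    fix e assume e: "e \<in> {e \<in> ?E. e \<subseteq> R}"
    then have e2: "card e = 2" "finite e" using E by (auto simp: nsets_def)
    have "v \<notin> e"
    proof
      assume "v \<in> e"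
      then obtain u where "e = {v, u}" using e2 by (auto simp: card_2_iff)
      then show False using e by (auto simp: R_def nbrs_def)
    qed
    then show "e \<in> nsets (R - {v}) 2" using e e2 by (auto simp: nsets_def)
  next
    fix e assume "e \<in> nsets (R - {v}) 2"
    then obtain p q where pq: "e = {p, q}" "p \<noteq> q" "p \<in> R - {v}" "q \<in> R - {v}"
      by (auto simp: nsets_def card_2_iff)
    then have "{v, p} \<notin> ?E" "{v, q} \<notin> ?E" "p < n" "q < n" "p \<noteq> v" "q \<noteq> v"
      by (auto simp: R_def nbrs_def X_def)
    then have "{p, q} \<in> ?E"
      using circulant_complement_triangle_free[OF _ _ _ v _ _ r(2), of p q] pq(2) by auto
    then show "e \<in> {e \<in> ?E. e \<subseteq> R}" using pq by auto
  qed
  then have "card {e \<in> ?E. e \<subseteq> R} = (n - 2 * r - 1) choose 2"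
    using R cR by (simp add: card_nsets_eq)
  moreover have "(\<Sum>u\<in>R. card (nbrs ?E u)) = (n - 2 * r) * (2 * r)"
    using card_nbrs_circulant r R(1) cR by (simp add: X_def subset_iff)
  moreover have "card ?E + card {e \<in> ?E. e \<subseteq> R}
      = card {e \<in> ?E. e \<subseteq> nbrs ?E v} + (\<Sum>u\<in>R. card (nbrs ?E u))"
    using card_edges_split[OF _ E R(1)] R(2) by (simp add: X_def)
  ultimately show ?thesis using card_circulant[OF r(1)] by simp
qed

text \<open>The threshold on \<open>d\<close> gives \<open>b >= 7/10 > 2/3\<close>, so a cycle power
  of degree just above \<open>b * n\<close> has triangle-free complement and the exact count
  applies.\<close>

lemma circulant_construction:
  fixes d :: real
  defines "b \<equiv> 1 / 2 + sqrt ((4 * d - 1) / 12)"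
  assumes d: "(47 - 5 * sqrt 57) / 24 \<le> d" "d < 1" and n: "b * real n + 3 < real n"
  shows "\<exists>(X :: nat set) \<F>. finite X \<and> card X = n \<and> \<F> \<subseteq> nsets X 3 \<and>
    d * real (n choose 2) \<le> real (min_degree X \<F>) \<and>
    real (card (shadow 3 X \<F>)) \<le> b * real (n choose 2) + 2 * real n"
proof -
  have "sqrt 57 < 756 / 100" by (intro real_less_lsqrt) (auto simp: power2_eq_square)
  then have d38: "38 / 100 < d" using d by simp
  define s where "s = sqrt ((4 * d - 1) / 12)"
  have s2: "s\<^sup>2 = (4 * d - 1) / 12" using d38 by (simp add: s_def)
  have s: "1 / 5 \<le> s"
    unfolding s_def using d38 by (intro real_le_rsqrt) (auto simp: power2_eq_square)
  have bs: "b = 1 / 2 + s" by (simp add: b_def s_def)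
  have npos: "real n > 0" using n by (cases "n = 0") auto
  \<comment> \<open>The degree \<open>2 * r\<close> is even, so no parity condition on
    \<open>n\<close> arises. Aiming at \<open>b * n + 1\<close> leaves an excess of at least 1, used
    below for the linear term.\<close>
  define r where "r = nat \<lceil>(b * n + 1) / 2\<rceil>"
  have "0 \<le> (b * n + 1) / 2" using bs s by simp
  then have "real r = of_int \<lceil>(b * n + 1) / 2\<rceil>" by (simp add: r_def)
  then have "(b * n + 1) / 2 \<le> real r" "real r \<le> (b * n + 1) / 2 + 1" by linarith+
  then have r: "b * n + 1 \<le> 2 * real r" "2 * real r \<le> b * n + 3" by (simp_all add: field_simps)
  have r2: "2 * r < n" using r n by linarith
  have "7 / 10 * real n \<le> b * n" using bs s by (intro mult_right_mono) auto
  then have r3: "n < 3 * r + 3" using r by linarith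
  define X where "X = {0..<n}"
  have X: "finite X" "card X = n" "X \<noteq> {}" using npos by (auto simp: X_def)
  have E: "circulant n r \<subseteq> nsets X 2" using circulant_nsets by (simp add: X_def)
  have t: "d * real (n choose 2) \<le> real (card {e \<in> circulant n r. e \<subseteq> nbrs (circulant n r) v})"
    (is "_ \<le> real ?t") if "v \<in> X" for v
  proof -
    define q where "q = 2 * real r"
    define c where "c = q - b * n"
    have c: "1 \<le> c" using r by (simp add: c_def q_def)
    have "?t + (n - 2 * r) * (2 * r) = n * r + ((n - 2 * r - 1) choose 2)"
      using that r2 r3 by (intro card_triangles_circulant) (auto simp: X_def)
    then have "2 * real ?t + 2 * real ((n - 2 * r) * (2 * r))
        = 2 * real (n * r) + 2 * real ((n - 2 * r - 1) choose 2)"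
      by linarith
    then have "2 * real ?t = n * q - 2 * (n - q) * q + (n - q - 1) * (n - q - 2)"
      unfolding real_choose_two using r2 by (simp add: of_nat_diff q_def algebra_simps)
    also have "\<dots> = 3 * (q - n / 2)\<^sup>2 + n\<^sup>2 / 4 - 3 * n + 3 * q + 2"
      by (simp add: power2_eq_square field_simps)
    \<comment> \<open>Completing the square at \<open>n / 2\<close> fits \<open>b = 1/2 + s\<close>:
      the leading coefficient becomes \<open>3 * s^2 + 1/4\<close>, which is exactly
      \<open>d\<close>.\<close>
    also have "q = n / 2 + s * n + c" by (simp add: c_def bs algebra_simps)
    finally have "2 * real ?t = (3 * s\<^sup>2 + 1 / 4) * n\<^sup>2 + (6 * c * s + 3 * s - 3 / 2) * n
        + 3 * c\<^sup>2 + 3 * c + 2"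
      by (simp add: power2_eq_square field_simps)
    moreover have "3 * s\<^sup>2 + 1 / 4 = d" using s2 by simp
    \<comment> \<open>With \<open>c >= 1\<close> and \<open>s >= 1/5\<close> the coefficient is at
      least \<open>6/5 + 3/5 - 3/2 > 0\<close>.\<close>
    moreover have "(6 * c * s + 3 * s - 3 / 2) * real n \<ge> 0 * real n"
    proof (rule mult_right_mono)
      have "1 * (1 / 5) \<le> c * s" using c s by (intro mult_mono) auto
      then show "0 \<le> 6 * c * s + 3 * s - 3 / 2" using s by simp
    qed simp
    ultimately have "d * n\<^sup>2 \<le> 2 * real ?t" using c by simp
    moreover have "d * (real n * (real n - 1)) \<le> d * n\<^sup>2"
      using d38 by (intro mult_left_mono) (auto simp: power2_eq_square intro: mult_left_mono)
    ultimately have "d * (2 * real (n choose 2)) \<le> 2 * real ?t"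
      unfolding real_choose_two by linarith
    then show ?thesis by simp
  qed
  have "sqrt ((4 * d - 1) / 12) \<le> 1 / 2"
    using d38 d by (intro real_le_lsqrt) (auto simp: power2_eq_square)
  then have b1: "b \<le> 1" by (simp add: b_def)
  have "2 * real (card (circulant n r)) = n * (2 * real r)"
    using card_circulant[OF r2] by simp
  also have "\<dots> \<le> n * (b * n + 3)" using r by (intro mult_left_mono) auto
  also have "\<dots> \<le> b * (n * (real n - 1)) + 4 * n"
    using b1 npos by (simp add: algebra_simps)
  finally have "real (card (circulant n r)) \<le> b * real (n choose 2) + 2 * n"
    unfolding real_choose_two[symmetric] by simp
  then show ?thesis
    using triangles_construction[OF X(1,3) E t] X
    by (intro exI[of _ X] exI[of _ "triangles X (circulant n r)"]) (auto simp: triangles_def)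
qed

section \<open>Lower bound and sharpness up to a linear term\<close>

theorem theorem1p3:
  fixes d :: real
  assumes "1 / 4 \<le> d" and "d < 1"
  shows "(\<exists>n\<^sub>0::nat. \<forall>n\<ge>n\<^sub>0. \<forall>(X :: 'a set) \<F>.
            finite X \<longrightarrow> card X = n \<longrightarrow> \<F> \<subseteq> nsets X 3 \<longrightarrow>
            real (min_degree X \<F>) \<ge> d * real (n choose 2) \<longrightarrow>
            real (card (shadow 3 X \<F>)) \<ge> shadow_density d * real (n choose 2)) \<and>
         (\<exists>C::real. \<exists>n\<^sub>1::nat. \<forall>n\<ge>n\<^sub>1. \<exists>(X :: nat set) \<F>.
            finite X \<and> card X = n \<and> \<F> \<subseteq> nsets X 3 \<and>
            real (min_degree X \<F>) \<ge> d * real (n choose 2) \<and>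
            real (card (shadow 3 X \<F>)) \<le> shadow_density d * real (n choose 2) + C * real n)"
proof
  show "\<exists>n\<^sub>0::nat. \<forall>n\<ge>n\<^sub>0. \<forall>(X :: 'a set) \<F>.
            finite X \<longrightarrow> card X = n \<longrightarrow> \<F> \<subseteq> nsets X 3 \<longrightarrow>
            real (min_degree X \<F>) \<ge> d * real (n choose 2) \<longrightarrow>
            real (card (shadow 3 X \<F>)) \<ge> shadow_density d * real (n choose 2)"
    \<comment> \<open>The threshold 2 suffices.\<close>
    using shadow_lower_bound[OF assms] by blast
next
  \<comment> \<open>Room for rounding up in both constructions: \<open>z\<close> is the relative
    clique size or the relative degree.\<close>
  have large: "\<exists>n\<^sub>1::nat. \<forall>n\<ge>n\<^sub>1. n > 0 \<and> z * real n + 3 < real n" if "z < 1" for z :: real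
  proof -
    obtain m :: nat where m: "3 / (1 - z) < real m" using reals_Archimedean2 by blast
    have "z * real n + 3 < real n" if "n \<ge> Suc m" for n
    proof -
      have "3 / (1 - z) < real n" using m that by linarith
      then have "3 < real n * (1 - z)" using \<open>z < 1\<close> by (simp add: pos_divide_less_eq)
      then show ?thesis by (simp add: algebra_simps)
    qed
    then show ?thesis by (intro exI[of _ "Suc m"]) auto
  qed
  show "\<exists>C::real. \<exists>n\<^sub>1::nat. \<forall>n\<ge>n\<^sub>1. \<exists>(X :: nat set) \<F>.
            finite X \<and> card X = n \<and> \<F> \<subseteq> nsets X 3 \<and>
            real (min_degree X \<F>) \<ge> d * real (n choose 2) \<and>
            real (card (shadow 3 X \<F>)) \<le> shadow_density d * real (n choose 2) + C * real n"
  proof (cases "d < (47 - 5 * sqrt 57) / 24")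
    case True
    have "sqrt d < 1" using assms by simp
    from large[OF this] obtain n\<^sub>1 where
      "\<And>n. n \<ge> n\<^sub>1 \<Longrightarrow> n > 0 \<and> sqrt d * real n + 3 < real n" by auto
    then have "\<forall>n\<ge>n\<^sub>1. \<exists>(X :: nat set) \<F>.
            finite X \<and> card X = n \<and> \<F> \<subseteq> nsets X 3 \<and>
            real (min_degree X \<F>) \<ge> d * real (n choose 2) \<and>
            real (card (shadow 3 X \<F>)) \<le> shadow_density d * real (n choose 2) + 10 * real n"
      using two_cliques_construction[OF assms] True
      by (simp add: shadow_density_def less_imp_le)
    then show ?thesis by blast
  next
    case False
    have "sqrt ((4 * d - 1) / 12) < 1 / 2"
      using assms by (intro real_less_lsqrt) (auto simp: power2_eq_square)
    then have "1 / 2 + sqrt ((4 * d - 1) / 12) < 1" by simp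
    from large[OF this] obtain n\<^sub>1 where
      "\<And>n. n \<ge> n\<^sub>1 \<Longrightarrow> (1 / 2 + sqrt ((4 * d - 1) / 12)) * real n + 3 < real n" by auto
    then have "\<forall>n\<ge>n\<^sub>1. \<exists>(X :: nat set) \<F>.
            finite X \<and> card X = n \<and> \<F> \<subseteq> nsets X 3 \<and>
            real (min_degree X \<F>) \<ge> d * real (n choose 2) \<and>
            real (card (shadow 3 X \<F>)) \<le> shadow_density d * real (n choose 2) + 2 * real n"
      using circulant_construction[of d] False assms
      by (simp add: shadow_density_def not_less)
    then show ?thesis by blast
  qed
qed

end
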